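(* Let $X$ be a real Hilbert space, let $I=\{1,\dots,m\}$ with $m\ge 1$, and for each $i\in I$ let $f_i\colon X\to\mathbb{R}$ be convex and continuous. Let $C:=\{x\in X : f_i(x)\le 0 \text{ for all } i\in I\}$ be nonempty, and suppose there is $L>0$ such that $\|u\|\le L$ for all $i\in I$, $x\in X$ and $u\in\partial f_i(x)$. Suppose there is $s\in X$ with $\max_{i\in I} f_i(s)<0$. Let $(\alpha_k)_{k\in\mathbb{N}}$ be a sequence of nonnegative real numbers such that $\sum_{k=0}^\infty\alpha_k=+\infty$ and $\sum_{k=0}^\infty\alpha_k^2<+\infty$. Then, for every starting point $x_0\in X$ and every choice of violated indices and subgradients, the subgradient algorithm with step sizes $(\alpha_k)_{k\in\mathbb{N}}$ finds a point in $C$ after finitely many steps, i.e., there is $K\in\mathbb{N}$ such that the iterate $x_K$ is generated and $x_K\in C$.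
   Context: $\mathbb{N}=\{0,1,2,\dots\}$. The convex subdifferential of $f\colon X\to\mathbb{R}$ at $x$ is $\partial f(x)=\{u\in X : f(x)+\langle y-x,u\rangle\le f(y)\text{ for all }y\in X\}$. Subgradient algorithm: given step sizes $(\alpha_k)_{k\in\mathbb{N}}$ in $[0,+\infty[$ and a starting point $x_0\in X$, proceed as follows for $k=0,1,2,\dots$. If $x_k\in C$, stop. Otherwise, pick any index $i_k\in I$ with $f_{i_k}(x_k)>0$ and any $g_k\in\partial f_{i_k}(x_k)$, and set $x_{k+1}:=x_k-\alpha_kg_k$. *)

theory Defs
  imports "HOL-Analysis.Analysis"
begin

definition subdifferential :: "('a::real_inner \<Rightarrow> real) \<Rightarrow> 'a \<Rightarrow> 'a set"
  where "subdifferential f x = {u. \<forall>y. f x + (y - x) \<bullet> u \<le> f y}"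

definition feasible_set :: "'i set \<Rightarrow> ('i \<Rightarrow> 'a \<Rightarrow> real) \<Rightarrow> 'a set"
  where "feasible_set I f = {x. \<forall>i\<in>I. f i x \<le> 0}"

definition admissible_choice ::
    "'i set \<Rightarrow> ('i \<Rightarrow> 'a::real_inner \<Rightarrow> real) \<Rightarrow> 'a \<Rightarrow> 'i \<Rightarrow> 'a \<Rightarrow> bool"
  where "admissible_choice I f x j u \<longleftrightarrow> j \<in> I \<and> f j x > 0 \<and> u \<in> subdifferential (f j) x"

text \<open>
  A complete execution of the subgradient algorithm. Exactly the iterates \<open>x k\<close> with \<open>enat k \<le> N\<close>
  are generated (\<open>N = \<infinity>\<close> if the algorithm never stops), the indices \<open>i k\<close> and subgradients \<open>g k\<close>
  matter only for \<open>enat k < N\<close>, and all other values of \<open>x\<close>, \<open>i\<close>, \<open>g\<close> are arbitrary.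
  An execution may be finite only if its last iterate is feasible or if no choice of a violated
  index and a subgradient exists there. The second alternative is included so that the definition
  does not presuppose that subgradients exist: such a stuck execution would not have found a
  feasible point.
\<close>
definition subgradient_run ::
    "'i set \<Rightarrow> ('i \<Rightarrow> 'a::real_inner \<Rightarrow> real) \<Rightarrow> (nat \<Rightarrow> real) \<Rightarrow> 'a
      \<Rightarrow> enat \<Rightarrow> (nat \<Rightarrow> 'a) \<Rightarrow> (nat \<Rightarrow> 'i) \<Rightarrow> (nat \<Rightarrow> 'a) \<Rightarrow> bool"
  where "subgradient_run I f \<alpha> x0 N x i g \<longleftrightarrow>
    x 0 = x0 \<and>
    (\<forall>k. enat k < N \<longrightarrow>
      x k \<notin> feasible_set I f \<and>
      admissible_choice I f (x k) (i k) (g k) \<and>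
      x (Suc k) = x k - \<alpha> k *\<^sub>R g k) \<and>
    (\<forall>n. N = enat n \<longrightarrow>
      x n \<in> feasible_set I f \<or> \<not> (\<exists>j u. admissible_choice I f (x n) j u))"

end

theory Submission
  imports Defs
begin

text \<open>
  Two things could prevent an execution from reaching \<open>C\<close>: it could go on forever, or it could get
  stuck at an infeasible iterate where the violated function has no subgradient.

  An infinite execution is excluded by following the distance to the Slater point \<open>s\<close>. If all
  \<open>f\<^sub>j s \<le> - \<delta>\<close> and \<open>f\<^sub>j\<close> is positive at the current iterate, then the subgradient inequality at \<open>s\<close>
  makes the step decrease the squared distance to \<open>s\<close> by at least
  \<open>2 \<delta> \<alpha>\<^sub>k - L\<^sup>2 \<alpha>\<^sub>k\<^sup>2\<close>. Summing up, \<open>2 \<delta> \<Sum> \<alpha>\<^sub>k \<le> \<parallel>x\<^sub>0 - s\<parallel>\<^sup>2 + L\<^sup>2 \<Sum> \<alpha>\<^sub>k\<^sup>2\<close>, which contradicts the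
  divergence of \<open>\<Sum> \<alpha>\<^sub>k\<close> (\<open>subgradient_steps_terminate\<close>).

  A stuck execution is excluded because a continuous convex function on a Hilbert space has a
  subgradient everywhere (\<open>subdifferential_nonempty\<close>). The Hilbert space structure allows a proof
  without the Hahn-Banach theorem: a linear functional below the directional derivative \<open>p\<close> is
  represented by \<open>- d\<close>, where \<open>d\<close> is the minimizer of \<open>p + \<parallel>\<cdot>\<parallel>\<^sup>2 / 2\<close>. This minimizer exists, as
  strong convexity makes every minimizing sequence Cauchy (\<open>sublinear_linear_minorant\<close>).
\<close>

section \<open>Linear minorants of sublinear functions\<close>

text \<open>
  If \<open>d\<close> minimizes \<open>p + \<parallel>\<cdot>\<parallel>\<^sup>2 / 2\<close>, then comparing \<open>d\<close> with \<open>d + t e\<close> gives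
  \<open>0 \<le> p e + d \<bullet> e + t \<parallel>e\<parallel>\<^sup>2 / 2\<close>, so \<open>- d\<close> represents a minorant as \<open>t\<close> tends to 0.
\<close>
lemma sublinear_linear_minorant:
  fixes p :: "'a::{real_inner, complete_space} \<Rightarrow> real"
  assumes subadd: "\<And>a b. p (a + b) \<le> p a + p b"
    and homogeneous: "\<And>c d. c > 0 \<Longrightarrow> p (c *\<^sub>R d) \<le> c * p d"
    and bound: "\<And>d. p d \<le> M * norm d"
  shows "\<exists>u. \<forall>d. d \<bullet> u \<le> p d"
proof -
  define \<phi> where "\<phi> d = p d + (norm d)\<^sup>2 / 2" for d
  define \<mu> where "\<mu> = (INF d. \<phi> d)"
  have lower: "- M * norm d \<le> p d" for d
  proof -
    have "p (2 *\<^sub>R 0) \<le> 2 * p 0" by (rule homogeneous) simp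
    moreover have "p 0 \<le> p d + p (- d)" using subadd[of d "- d"] by simp
    ultimately show ?thesis using bound[of "- d"] by simp
  qed
  have "- M\<^sup>2 / 2 \<le> \<phi> d" for d
    using lower[of d] zero_le_power2[of "norm d - M"]
    by (simp add: \<phi>_def power2_eq_square algebra_simps)
  then have bdd: "bdd_below (range \<phi>)" by (intro bdd_belowI2)
  have \<mu>_le: "\<mu> \<le> \<phi> d" for d
    unfolding \<mu>_def by (rule cINF_lower[OF bdd]) simp
  have "\<exists>d. \<phi> d < \<mu> + 1 / real (Suc n)" for n
  proof -
    have "Inf (range \<phi>) < \<mu> + 1 / real (Suc n)" by (simp add: \<mu>_def)
    then show ?thesis using cInf_lessD[of "range \<phi>"] by blast
  qed
  then obtain y where y: "\<And>n. \<phi> (y n) < \<mu> + 1 / real (Suc n)" by metis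
  have strongly_convex: "(norm (a - b))\<^sup>2 \<le> 4 * (\<phi> a + \<phi> b - 2 * \<mu>)" for a b
  proof -
    have "p ((1/2) *\<^sub>R (a + b)) \<le> (p a + p b) / 2"
      using homogeneous[of "1/2" "a + b"] subadd[of a b] by simp
    moreover have "(norm ((1/2) *\<^sub>R (a + b)))\<^sup>2 = (norm (a + b))\<^sup>2 / 4"
      by (simp add: power_divide)
    moreover have "(norm (a + b))\<^sup>2 + (norm (a - b))\<^sup>2 = 2 * (norm a)\<^sup>2 + 2 * (norm b)\<^sup>2"
      by (simp add: power2_norm_eq_inner algebra_simps inner_commute)
    ultimately show ?thesis
      using \<mu>_le[of "(1/2) *\<^sub>R (a + b)"] by (simp add: \<phi>_def)
  qed
  have "Cauchy y"
  proof (rule metric_CauchyI)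
    fix e :: real assume "e > 0"
    then have "0 < e\<^sup>2 / 8" by simp
    then obtain n0 where n0: "inverse (real (Suc n0)) < e\<^sup>2 / 8"
      using reals_Archimedean by blast
    have close: "\<phi> (y n) < \<mu> + e\<^sup>2 / 8" if "n \<ge> n0" for n
    proof -
      have "1 / real (Suc n) \<le> 1 / real (Suc n0)" using that by (intro divide_left_mono) auto
      then show ?thesis using y[of n] n0 by (simp add: inverse_eq_divide)
    qed
    have "dist (y a) (y b) < e" if "a \<ge> n0" "b \<ge> n0" for a b
    proof -
      have "(norm (y a - y b))\<^sup>2 < e\<^sup>2"
        using strongly_convex[of "y a" "y b"] close[OF that(1)] close[OF that(2)]
        by (simp add: field_simps)
      then show ?thesis using \<open>e > 0\<close> by (simp add: dist_norm power_less_imp_less_base)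
    qed
    then show "\<exists>n0. \<forall>a\<ge>n0. \<forall>b\<ge>n0. dist (y a) (y b) < e" by blast
  qed
  then obtain d where d: "y \<longlonglongrightarrow> d"
    using Cauchy_convergent convergent_def by blast
  \<comment> \<open>The inequality \<open>p d \<le> p (y n) + M * norm (d - y n)\<close> provides the lower
    semicontinuity that passing to the limit requires.\<close>
  have \<phi>_d: "\<phi> d \<le> \<mu>"
  proof (rule LIMSEQ_le_const)
    show "(\<lambda>n. \<mu> + 1 / real (Suc n) + M * norm (d - y n) + ((norm d)\<^sup>2 - (norm (y n))\<^sup>2) / 2) \<longlonglongrightarrow> \<mu>"
    proof -
      have "(\<lambda>n. \<mu> + 1 / real (Suc n) + M * norm (d - y n) + ((norm d)\<^sup>2 - (norm (y n))\<^sup>2) / 2)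
          \<longlonglongrightarrow> \<mu> + 0 + M * norm (d - d) + ((norm d)\<^sup>2 - (norm d)\<^sup>2) / 2"
        using LIMSEQ_inverse_real_of_nat
        by (intro tendsto_intros d) (simp_all add: inverse_eq_divide)
      then show ?thesis by simp
    qed
    have "\<phi> d \<le> \<mu> + 1 / real (Suc n) + M * norm (d - y n) + ((norm d)\<^sup>2 - (norm (y n))\<^sup>2) / 2" for n
      using subadd[of "y n" "d - y n"] bound[of "d - y n"] y[of n]
      by (simp add: \<phi>_def diff_divide_distrib)
    then show "\<exists>n0. \<forall>n\<ge>n0.
        \<phi> d \<le> \<mu> + 1 / real (Suc n) + M * norm (d - y n) + ((norm d)\<^sup>2 - (norm (y n))\<^sup>2) / 2"
      by blast
  qed
  have "e \<bullet> (- d) \<le> p e" for e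
  proof -
    have perturbed: "0 \<le> p e + d \<bullet> e + t * ((norm e)\<^sup>2 / 2)" if "t > 0" for t
    proof -
      have "(norm (d + t *\<^sub>R e))\<^sup>2 = (norm d)\<^sup>2 + 2 * t * (d \<bullet> e) + t\<^sup>2 * (norm e)\<^sup>2"
        by (simp only: power2_norm_eq_inner)
          (simp add: algebra_simps inner_commute power2_eq_square)
      moreover have "p (d + t *\<^sub>R e) \<le> p d + t * p e"
        using subadd[of d "t *\<^sub>R e"] homogeneous[OF that, of e] by simp
      moreover have "\<phi> d \<le> \<phi> (d + t *\<^sub>R e)"
        using \<phi>_d \<mu>_le[of "d + t *\<^sub>R e"] by simp
      ultimately have "0 \<le> t * (p e + d \<bullet> e + t * ((norm e)\<^sup>2 / 2))"
        by (simp add: \<phi>_def algebra_simps power2_eq_square add_divide_distrib)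
      then show ?thesis using that by (simp add: zero_le_mult_iff)
    qed
    have "0 \<le> p e + d \<bullet> e + 0 * ((norm e)\<^sup>2 / 2)"
    proof (rule tendsto_lowerbound)
      show "((\<lambda>t. p e + d \<bullet> e + t * ((norm e)\<^sup>2 / 2))
          \<longlongrightarrow> p e + d \<bullet> e + 0 * ((norm e)\<^sup>2 / 2)) (at_right 0)"
        by (intro tendsto_intros)
      show "\<forall>\<^sub>F t in at_right 0. 0 \<le> p e + d \<bullet> e + t * ((norm e)\<^sup>2 / 2)"
        using perturbed by (auto simp: eventually_at_right_field intro: exI[of _ 1])
    qed simp
    then show ?thesis by (simp add: inner_commute)
  qed
  then show ?thesis by blast
qed

section \<open>Existence of subgradients\<close>

text \<open>
  The linear minorant is taken of the directional derivative at \<open>x\<close>. Since the difference quotients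
  of a convex function decrease as the step length shrinks, this derivative is their infimum;
  working with the infimum avoids limits altogether.
\<close>
lemma subdifferential_nonempty:
  fixes f :: "'a::{real_inner, complete_space} \<Rightarrow> real"
  assumes convex: "convex_on UNIV f" and cont: "isCont f x"
  shows "subdifferential f x \<noteq> {}"
proof -
  define q where "q d t = (f (x + t *\<^sub>R d) - f x) / t" for d t
  define p where "p d = (INF t\<in>{0<..}. q d t)" for d
  have convexD: "f (u *\<^sub>R a + v *\<^sub>R b) \<le> u * f a + v * f b"
    if "u \<ge> 0" "v \<ge> 0" "u + v = 1" for u v a b
    using convex that by (simp add: convex_on_def)
  have q_lower: "f x - f (x - d) \<le> q d t" if "t > 0" for d t
  proof -
    \<comment> \<open>The point \<open>x\<close> divides the segment from \<open>x + t d\<close> to \<open>x - d\<close> in the ratio \<open>t : 1\<close>.\<close>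
    have "(1 / (1 + t)) *\<^sub>R (x + t *\<^sub>R d) + (t / (1 + t)) *\<^sub>R (x - d) = (1 / (1 + t) + t / (1 + t)) *\<^sub>R x"
      by (simp add: algebra_simps)
    also have "\<dots> = x" using that by (simp add: add_divide_distrib[symmetric])
    finally have "f x \<le> 1 / (1 + t) * f (x + t *\<^sub>R d) + t / (1 + t) * f (x - d)"
      using convexD[of "1 / (1 + t)" "t / (1 + t)" "x + t *\<^sub>R d" "x - d"] that
      by (simp add: add_divide_distrib[symmetric])
    also have "\<dots> = (f (x + t *\<^sub>R d) + t * f (x - d)) / (1 + t)"
      by (simp add: add_divide_distrib)
    finally show ?thesis using that by (simp add: q_def field_simps)
  qed
  have bdd: "bdd_below (q d ` {0<..})" for d
    using q_lower by (auto intro!: bdd_belowI)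
  have p_le: "p d \<le> q d t" if "t > 0" for d t
    unfolding p_def using that by (intro cINF_lower[OF bdd]) simp
  have p_greatest: "c \<le> p d" if "\<And>t. t > 0 \<Longrightarrow> c \<le> q d t" for c d
    unfolding p_def using that by (intro cINF_greatest) auto
  have subadd: "p (a + b) \<le> p a + p b" for a b
  proof -
    have "p (a + b) \<le> q a r + q b t" if "r > 0" "t > 0" for r t
    proof -
      \<comment> \<open>This \<open>\<tau>\<close> puts \<open>x + \<tau> (a + b)\<close> on the segment from \<open>x + r a\<close> to \<open>x + t b\<close>.\<close>
      define \<tau> where "\<tau> = r * t / (r + t)"
      have "\<tau> > 0" using that by (simp add: \<tau>_def)
      have weights: "t / (r + t) + r / (r + t) = 1"
        using that by (simp add: add_divide_distrib[symmetric])
      have "(t / (r + t)) *\<^sub>R (x + r *\<^sub>R a) + (r / (r + t)) *\<^sub>R (x + t *\<^sub>R b)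
          = (t / (r + t) + r / (r + t)) *\<^sub>R x + \<tau> *\<^sub>R (a + b)"
        by (simp add: \<tau>_def algebra_simps)
      then have "f (x + \<tau> *\<^sub>R (a + b)) \<le> t / (r + t) * f (x + r *\<^sub>R a) + r / (r + t) * f (x + t *\<^sub>R b)"
        using convexD[of "t / (r + t)" "r / (r + t)" "x + r *\<^sub>R a" "x + t *\<^sub>R b"] that weights
        by simp
      also have "\<dots> = \<tau> * (q a r + q b t) + (t / (r + t) + r / (r + t)) * f x"
        using that by (simp add: \<tau>_def q_def divide_simps) (simp add: algebra_simps)
      finally have "q (a + b) \<tau> \<le> q a r + q b t"
        unfolding weights q_def[of "a + b"] using \<open>\<tau> > 0\<close> by (simp add: field_simps)
      then show ?thesis using p_le[OF \<open>\<tau> > 0\<close>, of "a + b"] by simp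
    qed
    then have "p (a + b) - q b t \<le> p a" if "t > 0" for t
      using that by (intro p_greatest) (simp add: algebra_simps)
    then have "p (a + b) - p a \<le> p b"
      by (intro p_greatest) (simp add: algebra_simps)
    then show ?thesis by simp
  qed
  have homogeneous: "p (c *\<^sub>R d) \<le> c * p d" if "c > 0" for c d
  proof -
    have "p (c *\<^sub>R d) / c \<le> q d t" if "t > 0" for t
      using p_le[of "t / c" "c *\<^sub>R d"] that \<open>c > 0\<close> by (simp add: q_def field_simps)
    then have "p (c *\<^sub>R d) / c \<le> p d" by (rule p_greatest)
    then show ?thesis using that by (simp add: field_simps)
  qed
  obtain r where r: "r > 0" "\<And>y. dist y x < r \<Longrightarrow> dist (f y) (f x) < 1"
    using cont unfolding continuous_at_eps_delta by (meson zero_less_one)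
  have bound: "p d \<le> (2 / r) * norm d" for d
  proof (cases "d = 0")
    case True
    then show ?thesis using p_le[of 1 d] by (simp add: q_def)
  next
    case False
    define t where "t = r / (2 * norm d)"
    have "t > 0" using False r(1) by (simp add: t_def)
    have "dist (x + t *\<^sub>R d) x < r" using False r(1) by (simp add: t_def dist_norm)
    then have "f (x + t *\<^sub>R d) - f x \<le> 1" using r(2) by (fastforce simp: dist_real_def)
    then have "q d t \<le> 1 / t" using \<open>t > 0\<close> by (simp add: q_def divide_right_mono)
    then show ?thesis using p_le[OF \<open>t > 0\<close>, of d] by (simp add: t_def field_simps)
  qed
  obtain u where u: "\<And>d. d \<bullet> u \<le> p d"
    using sublinear_linear_minorant[of p, OF subadd homogeneous bound] by blast
  have "f x + (y - x) \<bullet> u \<le> f y" for y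
    using u[of "y - x"] p_le[of 1 "y - x"] by (simp add: q_def)
  then show ?thesis unfolding subdifferential_def by blast
qed

section \<open>Termination\<close>

text \<open>
  The hypothesis on \<open>(x k - s) \<bullet> g k\<close> says that each step points towards \<open>s\<close> with a uniform margin,
  so the squared distance to \<open>s\<close> drops by \<open>2 \<delta> \<alpha> k\<close> up to a summable error. Only finitely much
  squared distance is available, but the total of the steps is infinite.
\<close>
lemma subgradient_steps_terminate:
  fixes x g :: "nat \<Rightarrow> 'a::real_inner"
  assumes step: "\<And>k. x (Suc k) = x k - \<alpha> k *\<^sub>R g k"
    and bounded: "\<And>k. norm (g k) \<le> L"
    and margin: "\<And>k. \<delta> \<le> (x k - s) \<bullet> g k"
    and "\<delta> > 0"
    and nonneg: "\<And>k. \<alpha> k \<ge> 0"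
    and divergent: "filterlim (\<lambda>n. \<Sum>k<n. \<alpha> k) at_top sequentially"
    and square_summable: "summable (\<lambda>k. (\<alpha> k)\<^sup>2)"
  shows False
proof -
  have decrease: "(norm (x (Suc k) - s))\<^sup>2 \<le> (norm (x k - s))\<^sup>2 - 2 * \<delta> * \<alpha> k + L\<^sup>2 * (\<alpha> k)\<^sup>2" for k
  proof -
    have "(norm (x (Suc k) - s))\<^sup>2 = (norm ((x k - s) - \<alpha> k *\<^sub>R g k))\<^sup>2"
      by (simp add: step algebra_simps)
    also have "\<dots> = (norm (x k - s))\<^sup>2 - 2 * (\<alpha> k * ((x k - s) \<bullet> g k)) + (norm (g k))\<^sup>2 * (\<alpha> k)\<^sup>2"
      unfolding power2_norm_eq_inner by (simp add: inner_diff inner_commute power2_eq_square algebra_simps)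
    finally show ?thesis
      using mult_left_mono[OF margin nonneg, of k k]
        mult_right_mono[OF power_mono[OF bounded norm_ge_zero, of k 2] zero_le_power2, of "\<alpha> k"]
      by (simp add: mult_ac)
  qed
  have total: "(norm (x n - s))\<^sup>2 + 2 * \<delta> * (\<Sum>k<n. \<alpha> k) \<le> (norm (x 0 - s))\<^sup>2 + L\<^sup>2 * (\<Sum>k<n. (\<alpha> k)\<^sup>2)" for n
  proof (induction n)
    case (Suc n)
    then show ?case using decrease[of n] by (simp add: algebra_simps)
  qed simp
  have error: "L\<^sup>2 * (\<Sum>k<n. (\<alpha> k)\<^sup>2) \<le> L\<^sup>2 * (\<Sum>k. (\<alpha> k)\<^sup>2)" for n
    by (intro mult_left_mono sum_le_suminf[OF square_summable]) auto
  have "2 * \<delta> * (\<Sum>k<n. \<alpha> k) \<le> (norm (x 0 - s))\<^sup>2 + L\<^sup>2 * (\<Sum>k. (\<alpha> k)\<^sup>2)" for n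
    using total[of n] error[of n] zero_le_power2[of \<open>norm (x n - s)\<close>] by linarith
  then have "(\<Sum>k<n. \<alpha> k) \<le> ((norm (x 0 - s))\<^sup>2 + L\<^sup>2 * (\<Sum>k. (\<alpha> k)\<^sup>2)) / (2 * \<delta>)" for n
    using \<open>\<delta> > 0\<close> by (simp add: field_simps)
  moreover obtain n where "((norm (x 0 - s))\<^sup>2 + L\<^sup>2 * (\<Sum>k. (\<alpha> k)\<^sup>2)) / (2 * \<delta>) < (\<Sum>k<n. \<alpha> k)"
    using divergent unfolding filterlim_at_top_dense eventually_sequentially by (meson order_refl)
  ultimately show False by (meson not_less)
qed

theorem corollary2p5:
  fixes f :: "nat \<Rightarrow> 'a::{real_inner, complete_space} \<Rightarrow> real"
    and m :: nat and L :: real and s x0 :: 'a and \<alpha> :: "nat \<Rightarrow> real"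
    and N :: enat and x g :: "nat \<Rightarrow> 'a" and i :: "nat \<Rightarrow> nat"
  assumes "m \<ge> 1"
    and "\<And>j. j \<in> {1..m} \<Longrightarrow> convex_on UNIV (f j)"
    and "\<And>j. j \<in> {1..m} \<Longrightarrow> continuous_on UNIV (f j)"
    and "feasible_set {1..m} f \<noteq> {}"
    and "L > 0"
    and "\<And>j y u. j \<in> {1..m} \<Longrightarrow> u \<in> subdifferential (f j) y \<Longrightarrow> norm u \<le> L"
    and "(MAX j\<in>{1..m}. f j s) < 0"
    and "\<And>k. \<alpha> k \<ge> 0"
    and "filterlim (\<lambda>n. \<Sum>k<n. \<alpha> k) at_top sequentially"
    and "summable (\<lambda>k. (\<alpha> k)\<^sup>2)"
    and "subgradient_run {1..m} f \<alpha> x0 N x i g"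
  shows "\<exists>K. enat K \<le> N \<and> x K \<in> feasible_set {1..m} f"
proof (cases N)
  case (enat n)
  have "x n \<in> feasible_set {1..m} f"
  proof (rule ccontr)
    assume infeasible: "x n \<notin> feasible_set {1..m} f"
    then obtain j where j: "j \<in> {1..m}" "f j (x n) > 0"
      unfolding feasible_set_def by (auto simp: not_le)
    have "isCont (f j) (x n)"
      using assms(3)[OF j(1)] by (simp add: continuous_on_eq_continuous_at)
    then obtain u where "u \<in> subdifferential (f j) (x n)"
      using subdifferential_nonempty[OF assms(2)[OF j(1)]] by blast
    then have "admissible_choice {1..m} f (x n) j u"
      using j unfolding admissible_choice_def by blast
    then show False
      using assms(11) enat infeasible unfolding subgradient_run_def by blast
  qed
  then show ?thesis using enat by blast
next
  case infinity
  then have choice: "\<And>k. admissible_choice {1..m} f (x k) (i k) (g k)"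
    and step: "\<And>k. x (Suc k) = x k - \<alpha> k *\<^sub>R g k"
    using assms(11) unfolding subgradient_run_def by auto
  have bounded: "norm (g k) \<le> L" for k
    using choice[of k] assms(6) unfolding admissible_choice_def by blast
  define \<delta> where "\<delta> = - (MAX j\<in>{1..m}. f j s)"
  have "\<delta> > 0" using assms(7) by (simp add: \<delta>_def)
  have margin: "\<delta> \<le> (x k - s) \<bullet> g k" for k
  proof -
    have index: "i k \<in> {1..m}" and "f (i k) (x k) > 0"
      and "f (i k) (x k) + (s - x k) \<bullet> g k \<le> f (i k) s"
      using choice[of k] unfolding admissible_choice_def subdifferential_def by auto
    moreover have "f (i k) s \<le> - \<delta>"
      unfolding \<delta>_def minus_minus using index by (intro Max_ge) auto
    ultimately show ?thesis by (simp add: inner_diff_left)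
  qed
  show ?thesis
    using subgradient_steps_terminate[OF step bounded margin \<open>\<delta> > 0\<close> assms(8-10)] by blast
qed

end
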